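(* Let $G$ be a connected simple graph and let $G^{(1)}$ and $G^{(2)}$ be subgraphs of $G$ such that (1) every edge of $G$ belongs to $G^{(1)}$ or to $G^{(2)}$, and exactly one edge $e$ belongs to both; (2) $G^{(2)}$ is bipartite; and (3) $e$ lies on a cycle of $G^{(2)}$. Then the Ehrhart series factors as $H_G(t)=H_{G^{(1)}}(t)\bigl(H_{G^{(2)}}(t)(1-t)\bigr)$.
   Context: For a graph $H$ with vertices $v_1,\dots,v_n$, the edge polytope is $\mathcal{P}_H=\mathrm{conv}\{\mathbf{e}_i+\mathbf{e}_j:\{v_i,v_j\}\text{ an edge of }H\}\subset\mathbb{R}^n$ and its Ehrhart series is $H_H(t)=\sum_{m\ge0}|m\mathcal{P}_H\cap\mathbb{Z}^n|t^m$, with the $m=0$ term equal to $1$.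
   Formalization: The formal theorem also assumes that the only vertices common to G^(1) and G^(2) are the two ends of e; without this the claim fails, e.g. G=K_4, G^(2) the 4-cycle 12,23,34,41, G^(1)={12,13,24}, e=12 (t^2 coefficients 19 and 20). *)

theory Defs
  imports "HOL-Analysis.Analysis" "HOL-Computational_Algebra.Formal_Power_Series"
begin

text \<open>
  All graphs in a statement live on subsets of one finite vertex type, so that a subgraph
  shares its vertices with the ambient graph.
\<close>

record 'v ugraph =
  verts :: "'v set"
  edges :: "'v set set"

definition simple_graph :: "'v ugraph \<Rightarrow> bool" where
  "simple_graph G \<longleftrightarrow> finite (verts G) \<and> edges G \<subseteq> {e. e \<subseteq> verts G \<and> card e = 2}"

definition connected_graph :: "'v ugraph \<Rightarrow> bool" where
  "connected_graph G \<longleftrightarrow> verts G \<noteq> {} \<and>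
     (\<forall>u\<in>verts G. \<forall>v\<in>verts G. (u, v) \<in> {(x, y). {x, y} \<in> edges G}\<^sup>*)"

definition subgraph :: "'v ugraph \<Rightarrow> 'v ugraph \<Rightarrow> bool" where
  "subgraph H G \<longleftrightarrow> simple_graph H \<and> verts H \<subseteq> verts G \<and> edges H \<subseteq> edges G"

definition bipartite :: "'v ugraph \<Rightarrow> bool" where
  "bipartite G \<longleftrightarrow> (\<exists>A B. A \<union> B = verts G \<and> A \<inter> B = {} \<and>
     (\<forall>e\<in>edges G. \<exists>a\<in>A. \<exists>b\<in>B. e = {a, b}))"

text \<open>A cycle is given by its vertices in cyclic order.\<close>

definition cycle_edges :: "'v list \<Rightarrow> 'v set set" where
  "cycle_edges vs = {{vs ! i, vs ! (Suc i mod length vs)} | i. i < length vs}"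

definition cycle_of :: "'v ugraph \<Rightarrow> 'v list \<Rightarrow> bool" where
  "cycle_of G vs \<longleftrightarrow> 3 \<le> length vs \<and> distinct vs \<and> set vs \<subseteq> verts G \<and> cycle_edges vs \<subseteq> edges G"

text \<open>
  The polytope of \<open>H\<close> is taken in the coordinates of the whole vertex type. Coordinates outside
  \<open>verts H\<close> vanish on it, so its dilates have the same lattice points as in the
  coordinate space of \<open>verts H\<close> alone.
\<close>

definition edge_polytope :: "('v::finite) ugraph \<Rightarrow> (real ^ 'v) set" where
  "edge_polytope H = convex hull ((\<lambda>e. \<Sum>i\<in>e. axis i 1) ` edges H)"

definition lattice_points :: "(real ^ 'v::finite) set \<Rightarrow> (real ^ 'v) set" where
  "lattice_points S = {x \<in> S. \<forall>i. x $ i \<in> \<int>}"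

definition ehrhart_series :: "('v::finite) ugraph \<Rightarrow> int fps" where
  "ehrhart_series H = Abs_fps (\<lambda>m. if m = 0 then 1
     else int (card (lattice_points ((\<lambda>x. real m *\<^sub>R x) ` edge_polytope H))))"

end

theory Submission
  imports Defs
begin

text \<open>
  The lattice points of \<open>m\<P>\<^sub>H\<close> are the lattice points with coordinate sum \<open>2m\<close> in the cone spanned
  by the edge vectors of \<open>H\<close>. Let \<open>e = {u, v}\<close>. If a point \<open>z\<close> of the cone of the bipartite graph
  \<open>G2\<close> is integral off \<open>e\<close>, then some integral point of that cone is \<open>z\<close> minus a nonnegative multiple
  of the edge vector of \<open>e\<close>: as long as some edge weights of \<open>z\<close> are fractional, a dimension count
  yields a direction supported on them that changes the point only by a multiple of this vector.
  Hence every lattice point of the cone of \<open>G\<close> is, uniquely, a lattice point of the cone of \<open>G1\<close>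
  plus a lattice point of the cone of \<open>G2\<close> from which the vector of \<open>e\<close> cannot be subtracted, and the
  generating function of the latter points is \<open>H\<^bsub>G2\<^esub>(t)(1 - t)\<close>.
\<close>

section \<open>Edge vectors and their nonnegative combinations\<close>

definition edge_vec :: "'v::finite set \<Rightarrow> real ^ 'v" where
  "edge_vec f = (\<Sum>i\<in>f. axis i 1)"

definition edge_cone :: "'v::finite set set \<Rightarrow> (real ^ 'v) set" where
  "edge_cone E = {\<Sum>f\<in>E. w f *\<^sub>R edge_vec f | w. \<forall>f\<in>E. 0 \<le> w f}"

text \<open>Stated for an edge set without reference to its vertices, so that the condition passes
  to every subset, in particular to the edges of fractional weight.\<close>

definition bipartite_edges :: "'v set \<Rightarrow> 'v set \<Rightarrow> 'v set set \<Rightarrow> bool" where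
  "bipartite_edges A B E \<longleftrightarrow> A \<inter> B = {} \<and> (\<forall>f\<in>E. \<exists>a\<in>A. \<exists>b\<in>B. f = {a, b})"

lemma edge_vec_nth: "edge_vec f $ i = (if i \<in> f then 1 else 0)"
proof -
  have "edge_vec f $ i = (\<Sum>j\<in>f. if i = j then 1 else 0)"
    unfolding edge_vec_def sum_component by (intro sum.cong) (auto simp: axis_def)
  then show ?thesis by simp
qed

lemma edge_comb_nth: "(\<Sum>f\<in>E. w f *\<^sub>R edge_vec f) $ i = (\<Sum>f\<in>{f\<in>E. i \<in> f}. w f)"
  for E :: "'v::finite set set"
  by (simp add: sum_component edge_vec_nth if_distrib sum.inter_filter cong: if_cong)

lemma sum_edge_vec: "(\<Sum>i\<in>S. edge_vec f $ i) = card (S \<inter> f)"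
  by (simp add: edge_vec_nth flip: sum.inter_restrict)

lemma sum_edge_comb:
  fixes E :: "'v::finite set set"
  shows "(\<Sum>i\<in>S. (\<Sum>f\<in>E. w f *\<^sub>R edge_vec f) $ i) = (\<Sum>f\<in>E. w f * card (S \<inter> f))"
proof -
  have "(\<Sum>i\<in>S. (\<Sum>f\<in>E. w f *\<^sub>R edge_vec f) $ i) = (\<Sum>f\<in>E. \<Sum>i\<in>S. w f * edge_vec f $ i)"
    by (simp add: sum_component) (rule sum.swap)
  then show ?thesis by (simp add: sum_edge_vec flip: sum_distrib_left)
qed

lemma bipartite_edges_card_Int:
  assumes "bipartite_edges A B E" and "f \<in> E"
  shows "card (A \<inter> f) = 1" and "card (B \<inter> f) = 1" and "card f = 2"
proof -
  obtain a b where "a \<in> A" "b \<in> B" "f = {a, b}" "A \<inter> B = {}"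
    using assms unfolding bipartite_edges_def by blast
  moreover from this have "A \<inter> f = {a}" "B \<inter> f = {b}" "a \<noteq> b" by auto
  ultimately show "card (A \<inter> f) = 1" and "card (B \<inter> f) = 1" and "card f = 2" by auto
qed

text \<open>An edge has exactly one end in \<open>A\<close> and one in \<open>B\<close>, so it adds
  its weight once to either side. The weights may have any sign, which allows use on linear
  relations as well as on cone points.\<close>

lemma bipartite_comb_balanced:
  fixes E :: "'v::finite set set"
  assumes "bipartite_edges A B E"
  shows "(\<Sum>i\<in>A. (\<Sum>f\<in>E. w f *\<^sub>R edge_vec f) $ i) = (\<Sum>i\<in>B. (\<Sum>f\<in>E. w f *\<^sub>R edge_vec f) $ i)"
  unfolding sum_edge_comb using bipartite_edges_card_Int[OF assms] by simp

text \<open>The sums over \<open>A\<close> and \<open>B\<close> shrink to the single terms at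
  \<open>u\<close> and \<open>v\<close>, so these two coordinates agree. This is how multiples of
  the edge vector are recognized below.\<close>

lemma balanced_on_edge:
  fixes D :: "real ^ 'v::finite"
  assumes "A \<inter> B = {}" and "u \<in> A" and "v \<in> B"
    and bal: "(\<Sum>i\<in>A. D $ i) = (\<Sum>i\<in>B. D $ i)"
    and supp: "\<And>i. i \<notin> {u, v} \<Longrightarrow> D $ i = 0"
  shows "D = (D $ u) *\<^sub>R edge_vec {u, v}"
proof -
  have "D $ i = 0" if "i \<in> A - {u} \<or> i \<in> B - {v}" for i
    using that assms(1-3) by (intro supp) blast
  then have "(\<Sum>i\<in>A. D $ i) = (\<Sum>i\<in>{u}. D $ i)" "(\<Sum>i\<in>B. D $ i) = (\<Sum>i\<in>{v}. D $ i)"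
    using assms(2,3) by (intro sum.mono_neutral_right; simp)+
  then have "D $ u = D $ v" using bal by simp
  then show ?thesis using supp by (auto simp: vec_eq_iff edge_vec_nth)
qed

section \<open>Linear relations among the edge vectors\<close>

text \<open>Gaussian elimination: either the new equation \<open>i\<close> is vacuous on
  \<open>F\<close>, or it can be solved for an unknown \<open>g\<close>, leaving one equation and
  one unknown fewer.\<close>

lemma underdetermined_system:
  fixes M :: "'i \<Rightarrow> 'f \<Rightarrow> real"
  assumes "finite W" and "finite F" and "card W < card F"
  shows "\<exists>d. (\<exists>f\<in>F. d f \<noteq> 0) \<and> (\<forall>i\<in>W. (\<Sum>f\<in>F. M i f * d f) = 0)"
  using assms
proof (induction W arbitrary: F M rule: finite_induct)
  case empty
  then have "F \<noteq> {}" by auto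
  then show ?case by (intro exI[of _ "\<lambda>_. 1"]) auto
next
  case (insert i W)
  show ?case
  proof (cases "\<forall>f\<in>F. M i f = 0")
    case True
    moreover have "card W < card F" using insert by simp
    then obtain d where "\<exists>f\<in>F. d f \<noteq> 0" "\<forall>i\<in>W. (\<Sum>f\<in>F. M i f * d f) = 0"
      using insert.IH[OF insert.prems(1), of M] by blast
    ultimately show ?thesis by (intro exI[of _ d]) simp
  next
    case False
    then obtain g where g: "g \<in> F" "M i g \<noteq> 0" by auto
    define F' where "F' = F - {g}"
    have fin: "finite F'" and F: "F = insert g F'" "g \<notin> F'"
      using insert.prems g by (auto simp: F'_def)
    have "card W < card F'" using insert F fin by simp
    \<comment> \<open>These are the coefficients of equation \<open>j\<close> after the value of
      unknown \<open>g\<close> given by equation \<open>i\<close> has been substituted;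
      \<open>d'\<close> then restores that unknown.\<close>
    from insert.IH[OF fin this, of "\<lambda>j f. M j f - M j g * M i f / M i g"]
    obtain d where d: "\<exists>f\<in>F'. d f \<noteq> 0"
      "\<And>j. j \<in> W \<Longrightarrow> (\<Sum>f\<in>F'. (M j f - M j g * M i f / M i g) * d f) = 0" by auto
    define S where "S j = (\<Sum>f\<in>F'. M j f * d f)" for j
    define d' where "d' = d(g := - S i / M i g)"
    have sum_d': "(\<Sum>f\<in>F. M j f * d' f) = M j g * (- S i / M i g) + S j" for j
    proof -
      have "(\<Sum>f\<in>F'. M j f * d' f) = S j"
        unfolding S_def d'_def using F by (intro sum.cong) auto
      then show ?thesis using F fin by (simp add: d'_def)
    qed
    have "(\<Sum>f\<in>F. M j f * d' f) = 0" if "j \<in> W" for j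
    proof -
      have "0 = (\<Sum>f\<in>F'. M j f * d f - M j g / M i g * (M i f * d f))"
        using d(2)[OF that] by (simp add: algebra_simps)
      also have "\<dots> = S j - M j g / M i g * S i"
        by (simp add: S_def sum_subtractf sum_distrib_left)
      finally show ?thesis by (simp add: sum_d')
    qed
    moreover have "(\<Sum>f\<in>F. M i f * d' f) = 0" using g by (simp add: sum_d')
    moreover have "\<exists>f\<in>F. d' f \<noteq> 0" using d(1) F by (auto simp: d'_def)
    ultimately show ?thesis by blast
  qed
qed

lemma sum_degrees:
  fixes F :: "'v::finite set set"
  shows "(\<Sum>i\<in>UNIV. card {f\<in>F. i \<in> f}) = (\<Sum>f\<in>F. card f)"
proof -
  have "(\<Sum>i\<in>(UNIV::'v set). card {f\<in>F. i \<in> f}) = (\<Sum>i\<in>(UNIV::'v set). \<Sum>f\<in>F. if i \<in> f then 1 else 0)"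
    by (simp add: sum.inter_filter[symmetric])
  also have "\<dots> = (\<Sum>f\<in>F. \<Sum>i\<in>(UNIV::'v set). if i \<in> f then 1 else 0)" by (rule sum.swap)
  also have "\<dots> = (\<Sum>f\<in>F. card f)" by (intro sum.cong) (auto simp: sum.If_cases)
  finally show ?thesis .
qed

text \<open>The unknowns are weights on \<open>F\<close>, and the equations say that the coordinates
  at the vertices in \<open>W\<close> vanish. Each of these vertices has degree at least 2 in
  \<open>F\<close>, so counting incidences gives \<open>card W \<le> card F\<close>. A solution is
  supported on \<open>{u, v}\<close> and balanced, hence a multiple of the edge vector, of unknown
  sign and possibly zero.\<close>

lemma edge_relation_exists:
  fixes F :: "'v::finite set set"
  assumes bip: "bipartite_edges A B F" and uv: "u \<in> A" "v \<in> B" and "F \<noteq> {}"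
    and deg: "\<And>i. i \<notin> {u, v} \<Longrightarrow> card {f\<in>F. i \<in> f} \<noteq> 1"
  shows "\<exists>d q. (\<exists>f\<in>F. d f \<noteq> 0) \<and> (\<Sum>f\<in>F. d f *\<^sub>R edge_vec f) = q *\<^sub>R edge_vec {u, v}"
proof -
  define W where "W = \<Union>F - {u, v}"
  define D where "D d = (\<Sum>f\<in>F. d f *\<^sub>R edge_vec f)" for d
  have D_nth: "D d $ i = (\<Sum>f\<in>F. edge_vec f $ i * d f)" for d i
    by (simp add: D_def sum_component mult.commute)
  have "2 * card W = (\<Sum>i\<in>W. 2)" by simp
  also have "\<dots> \<le> (\<Sum>i\<in>W. card {f\<in>F. i \<in> f})"
  proof (rule sum_mono)
    fix i assume "i \<in> W"
    then have "{f\<in>F. i \<in> f} \<noteq> {}" "i \<notin> {u, v}" by (auto simp: W_def)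
    then have "card {f\<in>F. i \<in> f} \<noteq> 0" "card {f\<in>F. i \<in> f} \<noteq> 1" using deg by (simp, blast)
    then show "2 \<le> card {f\<in>F. i \<in> f}" by linarith
  qed
  finally have "2 * card W + (\<Sum>i\<in>-W. card {f\<in>F. i \<in> f}) \<le> (\<Sum>i\<in>UNIV. card {f\<in>F. i \<in> f})"
    by (simp add: sum.subset_diff[of W UNIV] Compl_eq_Diff_UNIV)
  also have "\<dots> = 2 * card F"
    unfolding sum_degrees using bipartite_edges_card_Int(3)[OF bip] by simp
  finally have count: "2 * card W + (\<Sum>i\<in>-W. card {f\<in>F. i \<in> f}) \<le> 2 * card F" .
  have "\<exists>d. (\<exists>f\<in>F. d f \<noteq> 0) \<and> (\<forall>i\<in>W. D d $ i = 0)"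
  proof (cases "card W < card F")
    case True
    then show ?thesis
      using underdetermined_system[of W F "\<lambda>i f. edge_vec f $ i"] by (simp add: D_nth)
  next
    case False
    \<comment> \<open>Then \<open>F\<close> avoids \<open>{u, v}\<close>, so one of the equations follows from the others by bipartiteness.\<close>
    then have "(\<Sum>i\<in>-W. card {f\<in>F. i \<in> f}) = 0" and card: "card F = card W"
      using count by linarith+
    then have out: "f \<in> F \<Longrightarrow> i \<notin> W \<Longrightarrow> i \<notin> f" for f i by auto
    obtain f where f: "f \<in> F" using \<open>F \<noteq> {}\<close> by auto
    then obtain j where "j \<in> f" "j \<in> A"
      using bip unfolding bipartite_edges_def by blast
    with f out have j: "j \<in> W" "j \<in> A" "j \<notin> B"
      using bip unfolding bipartite_edges_def by blast+
    then have "card (W - {j}) < card F"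
      by (metis card card_Diff1_less finite)
    then obtain d where d: "\<exists>f\<in>F. d f \<noteq> 0" "\<forall>i\<in>W - {j}. D d $ i = 0"
      using underdetermined_system[of "W - {j}" F "\<lambda>i f. edge_vec f $ i"] by (auto simp: D_nth)
    have zero: "D d $ i = 0" if "i \<noteq> j" for i
    proof (cases "i \<in> W")
      case True then show ?thesis using d(2) that by blast
    next
      case False
      then have none: "{f\<in>F. i \<in> f} = {}" using out by blast
      show ?thesis unfolding D_def edge_comb_nth none by simp
    qed
    have "D d $ j = (\<Sum>i\<in>A. D d $ i)"
      using zero j by (subst sum.mono_neutral_right[of A "{j}"]) auto
    also have "\<dots> = (\<Sum>i\<in>B. D d $ i)"
      unfolding D_def by (rule bipartite_comb_balanced[OF bip])
    also have "\<dots> = 0" using zero j by (intro sum.neutral) metis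
    finally show ?thesis using d zero by metis
  qed
  then obtain d where d: "\<exists>f\<in>F. d f \<noteq> 0" "\<And>i. i \<in> W \<Longrightarrow> D d $ i = 0" by blast
  have "D d $ i = 0" if "i \<notin> {u, v}" for i
  proof (cases "i \<in> W")
    case False
    then have none: "{f\<in>F. i \<in> f} = {}" using that unfolding W_def by blast
    show ?thesis unfolding D_def edge_comb_nth none by simp
  qed (rule d)
  moreover have "(\<Sum>i\<in>A. D d $ i) = (\<Sum>i\<in>B. D d $ i)"
    unfolding D_def by (rule bipartite_comb_balanced[OF bip])
  ultimately have "D d = (D d $ u) *\<^sub>R edge_vec {u, v}"
    using bip uv unfolding bipartite_edges_def by (intro balanced_on_edge[of A B]) auto
  then show ?thesis using d(1) unfolding D_def by blast
qed

section \<open>Rounding fractional edge weights\<close>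

text \<open>Moving along \<open>d\<close>, stop when the first coordinate becomes an integer; up to
  then none has dropped below its floor. The floor bound is what keeps nonnegative weights
  nonnegative.\<close>

lemma move_to_integer:
  fixes w d :: "'f \<Rightarrow> real"
  assumes "finite F" and nonint: "\<And>f. f \<in> F \<Longrightarrow> w f \<notin> \<int>" and "\<exists>f\<in>F. d f \<noteq> 0"
  shows "\<exists>t>0. (\<forall>f\<in>F. of_int \<lfloor>w f\<rfloor> \<le> w f + t * d f) \<and> (\<exists>f\<in>F. w f + t * d f \<in> \<int>)"
proof -
  define F' where "F' = {f\<in>F. d f \<noteq> 0}"
  \<comment> \<open>The time at which coordinate \<open>f\<close> reaches the next integer in its
    direction of movement. Coordinates with \<open>d f = 0\<close> do not move and are left out of
    \<open>F'\<close>.\<close>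
  define T where "T f = (if d f > 0 then (of_int \<lceil>w f\<rceil> - w f) / d f else (of_int \<lfloor>w f\<rfloor> - w f) / d f)" for f
  have fin: "finite (T ` F')" "T ` F' \<noteq> {}" using assms by (auto simp: F'_def)
  have lt: "of_int \<lfloor>w f\<rfloor> < w f" "w f < of_int \<lceil>w f\<rceil>" if "f \<in> F" for f
  proof -
    have "w f \<noteq> of_int \<lfloor>w f\<rfloor>" "w f \<noteq> of_int \<lceil>w f\<rceil>"
      using nonint[OF that] by (metis Ints_of_int)+
    then show "of_int \<lfloor>w f\<rfloor> < w f" "w f < of_int \<lceil>w f\<rceil>"
      using of_int_floor_le[of "w f"] le_of_int_ceiling[of "w f"] by (metis less_le)+
  qed
  have pos: "T f > 0" if "f \<in> F'" for f
    using that lt[of f] unfolding T_def F'_def by (auto simp: zero_less_divide_iff)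
  define t where "t = Min (T ` F')"
  have "t \<in> T ` F'" unfolding t_def using fin by (rule Min_in)
  then obtain g where g: "g \<in> F'" "t = T g" by auto
  have "w g + t * d g \<in> \<int>" using g by (auto simp: T_def F'_def)
  moreover have "g \<in> F" using g by (simp add: F'_def)
  moreover have "of_int \<lfloor>w f\<rfloor> \<le> w f + t * d f" if f: "f \<in> F" for f
  proof (cases "d f < 0")
    case True
    then have "t \<le> (of_int \<lfloor>w f\<rfloor> - w f) / d f"
      using fin(1) f Min_le[of "T ` F'" "T f"] by (auto simp: t_def T_def F'_def)
    then show ?thesis using True by (simp add: field_simps)
  next
    case False
    then have "0 \<le> t * d f" using pos g by (simp add: less_imp_le)
    then show ?thesis using lt(1)[OF f] by linarith
  qed
  ultimately show ?thesis using pos g by blast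
qed

text \<open>A single non-integer cannot be compensated by integers. Applied to the edges at a
  vertex, this gives the degree condition of \<open>edge_relation_exists\<close> for the edges of
  fractional weight.\<close>

lemma degree_nonintegral_ne_1:
  fixes w :: "'f \<Rightarrow> real"
  assumes "finite E" and "(\<Sum>f\<in>E. w f) \<in> \<int>"
  shows "card {f\<in>E. w f \<notin> \<int>} \<noteq> 1"
proof
  assume "card {f\<in>E. w f \<notin> \<int>} = 1"
  then obtain g where g: "{f\<in>E. w f \<notin> \<int>} = {g}" by (auto simp: card_1_singleton_iff)
  then have "g \<in> E" "w g \<notin> \<int>" by auto
  have "(\<Sum>f\<in>E - {g}. w f) \<in> \<int>" using g by (intro Ints_sum) auto
  moreover have "w g = (\<Sum>f\<in>E. w f) - (\<Sum>f\<in>E - {g}. w f)"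
    using \<open>g \<in> E\<close> assms(1) by (simp add: sum.remove)
  ultimately show False using assms(2) \<open>w g \<notin> \<int>\<close> by simp
qed

text \<open>Induction on the number of fractional weights: moving along a relation among their edges
  makes at least one of them integral and changes the point only by a multiple of the vector of
  \<open>{u, v}\<close>.\<close>

lemma bipartite_weights_rounding:
  fixes E :: "'v::finite set set"
  assumes bip: "bipartite_edges A B E" and uv: "u \<in> A" "v \<in> B"
    and "\<And>f. f \<in> E \<Longrightarrow> 0 \<le> w f"
    and "\<And>i. i \<notin> {u, v} \<Longrightarrow> (\<Sum>f\<in>E. w f *\<^sub>R edge_vec f) $ i \<in> \<int>"
  shows "\<exists>w' c. 0 \<le> c \<and> (\<forall>f\<in>E. 0 \<le> w' f \<and> w' f \<in> \<int>) \<and>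
    (\<Sum>f\<in>E. w f *\<^sub>R edge_vec f) = (\<Sum>f\<in>E. w' f *\<^sub>R edge_vec f) + c *\<^sub>R edge_vec {u, v}"
  using assms(4,5)
proof (induction "card {f\<in>E. w f \<notin> \<int>}" arbitrary: w rule: less_induct)
  case less
  define F where "F = {f\<in>E. w f \<notin> \<int>}"
  show ?case
  proof (cases "F = {}")
    case True
    then show ?thesis using less.prems by (intro exI[of _ w] exI[of _ 0]) (auto simp: F_def)
  next
    case False
    have bipF: "bipartite_edges A B F" using bip unfolding bipartite_edges_def F_def by blast
    have "card {f\<in>F. i \<in> f} \<noteq> 1" if "i \<notin> {u, v}" for i
    proof -
      have "{f\<in>F. i \<in> f} = {f\<in>{f\<in>E. i \<in> f}. w f \<notin> \<int>}" by (auto simp: F_def)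
      then show ?thesis
        using degree_nonintegral_ne_1[of "{f\<in>E. i \<in> f}" w] less.prems(2)[OF that]
        unfolding edge_comb_nth by simp
    qed
    from edge_relation_exists[OF bipF uv False this] obtain d0 q0 where
      d0: "\<exists>f\<in>F. d0 f \<noteq> 0" "(\<Sum>f\<in>F. d0 f *\<^sub>R edge_vec f) = q0 *\<^sub>R edge_vec {u, v}" by blast
    \<comment> \<open>The sign orients the relation so that \<open>s * q0 \<le> 0\<close>: the
      movement can only subtract from the point, and the multiple split off is nonnegative.\<close>
    define s :: real where "s = (if q0 \<le> 0 then 1 else - 1)"
    define d where "d f = (if f \<in> F then s * d0 f else 0)" for f
    have d_ne: "\<exists>f\<in>F. d f \<noteq> 0" using d0(1) by (auto simp: d_def s_def)
    have "(\<Sum>f\<in>E. d f *\<^sub>R edge_vec f) = (\<Sum>f\<in>F. d f *\<^sub>R edge_vec f)"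
      by (intro sum.mono_neutral_right) (auto simp: d_def F_def)
    also have "\<dots> = s *\<^sub>R (\<Sum>f\<in>F. d0 f *\<^sub>R edge_vec f)"
      by (simp add: d_def scaleR_sum_right)
    also have "\<dots> = (s * q0) *\<^sub>R edge_vec {u, v}" by (simp add: d0)
    finally have d: "(\<Sum>f\<in>E. d f *\<^sub>R edge_vec f) = (s * q0) *\<^sub>R edge_vec {u, v}" .
    obtain t where t: "t > 0" "\<forall>f\<in>F. of_int \<lfloor>w f\<rfloor> \<le> w f + t * d f" "\<exists>f\<in>F. w f + t * d f \<in> \<int>"
      using move_to_integer[OF finite _ d_ne, of w] unfolding F_def by blast
    define w1 where "w1 f = w f + t * d f" for f
    have w: "(\<Sum>f\<in>E. w f *\<^sub>R edge_vec f) =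
      (\<Sum>f\<in>E. w1 f *\<^sub>R edge_vec f) + (- t * s * q0) *\<^sub>R edge_vec {u, v}"
    proof -
      have "(\<Sum>f\<in>E. w1 f *\<^sub>R edge_vec f) =
        (\<Sum>f\<in>E. w f *\<^sub>R edge_vec f) + t *\<^sub>R (\<Sum>f\<in>E. d f *\<^sub>R edge_vec f)"
        by (simp add: w1_def scaleR_left_distrib sum.distrib scaleR_sum_right)
      then show ?thesis by (simp add: d)
    qed
    have c: "0 \<le> - t * s * q0" using t(1) by (simp add: s_def mult_nonneg_nonpos)
    \<comment> \<open>Integral weights stay put because \<open>d\<close> vanishes off
      \<open>F\<close>, while some weight in \<open>F\<close> has become integral.\<close>
    have "{f\<in>E. w1 f \<notin> \<int>} \<subset> F"
      using t(3) by (auto simp: w1_def d_def F_def)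
    then have smaller: "card {f\<in>E. w1 f \<notin> \<int>} < card {f\<in>E. w f \<notin> \<int>}"
      unfolding F_def by (intro psubset_card_mono) auto
    have "0 \<le> w1 f" if "f \<in> E" for f
    proof (cases "f \<in> F")
      case True
      have "0 \<le> real_of_int \<lfloor>w f\<rfloor>" using less.prems(1)[OF that] by simp
      also have "\<dots> \<le> w1 f" using t(2) True unfolding w1_def by blast
      finally show ?thesis .
    qed (use less.prems(1)[OF that] in \<open>simp add: w1_def d_def\<close>)
    \<comment> \<open>The vector of \<open>{u, v}\<close> vanishes at \<open>i\<close>, so the
      movement leaves this coordinate unchanged.\<close>
    moreover have "(\<Sum>f\<in>E. w1 f *\<^sub>R edge_vec f) $ i \<in> \<int>" if "i \<notin> {u, v}" for i
    proof -
      have "(\<Sum>f\<in>E. w f *\<^sub>R edge_vec f) $ i = (\<Sum>f\<in>E. w1 f *\<^sub>R edge_vec f) $ i"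
        using arg_cong[OF w, of "\<lambda>x. x $ i"] that by (simp add: edge_vec_nth del: sum_component)
      then show ?thesis using less.prems(2)[OF that] by simp
    qed
    ultimately obtain w' c' where w': "0 \<le> c'" "\<forall>f\<in>E. 0 \<le> w' f \<and> w' f \<in> \<int>"
      "(\<Sum>f\<in>E. w1 f *\<^sub>R edge_vec f) = (\<Sum>f\<in>E. w' f *\<^sub>R edge_vec f) + c' *\<^sub>R edge_vec {u, v}"
      using less.hyps[OF smaller] by blast
    then show ?thesis
      using c by (intro exI[of _ w'] exI[of _ "c' + - t * s * q0"])
        (simp add: w scaleR_left_diff_distrib)
  qed
qed

section \<open>Properties of the edge cone\<close>

lemma edge_cone_add: "x \<in> edge_cone E \<Longrightarrow> y \<in> edge_cone E \<Longrightarrow> x + y \<in> edge_cone E"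
  for E :: "'v::finite set set"
proof -
  assume "x \<in> edge_cone E" "y \<in> edge_cone E"
  then obtain w w' where "x = (\<Sum>f\<in>E. w f *\<^sub>R edge_vec f)" "\<forall>f\<in>E. 0 \<le> w f"
    "y = (\<Sum>f\<in>E. w' f *\<^sub>R edge_vec f)" "\<forall>f\<in>E. 0 \<le> w' f" unfolding edge_cone_def by blast
  then show ?thesis unfolding edge_cone_def
    by (auto intro!: exI[of _ "\<lambda>f. w f + w' f"] simp: scaleR_left_distrib sum.distrib)
qed

lemma edge_cone_mono:
  fixes E E' :: "'v::finite set set"
  assumes "E \<subseteq> E'"
  shows "edge_cone E \<subseteq> edge_cone E'"
proof
  fix x assume "x \<in> edge_cone E"
  then obtain w where w: "x = (\<Sum>f\<in>E. w f *\<^sub>R edge_vec f)" "\<forall>f\<in>E. 0 \<le> w f"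
    unfolding edge_cone_def by blast
  have "x = (\<Sum>f\<in>E'. (if f \<in> E then w f else 0) *\<^sub>R edge_vec f)"
    unfolding w(1) using assms by (intro sum.mono_neutral_cong_left) auto
  then show "x \<in> edge_cone E'" using w(2) unfolding edge_cone_def by auto
qed

lemma scaled_edge_in_edge_cone:
  fixes E :: "'v::finite set set"
  assumes "e \<in> E" and "0 \<le> c"
  shows "c *\<^sub>R edge_vec e \<in> edge_cone E"
proof -
  have "c *\<^sub>R edge_vec e \<in> edge_cone {e}" using assms(2) unfolding edge_cone_def by auto
  then show ?thesis using edge_cone_mono[of "{e}" E] assms(1) by blast
qed

lemma edge_cone_union:
  fixes E1 E2 :: "'v::finite set set"
  assumes "x \<in> edge_cone (E1 \<union> E2)"
  obtains y z where "y \<in> edge_cone E1" "z \<in> edge_cone E2" "x = y + z"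
proof -
  obtain w where w: "x = (\<Sum>f\<in>E1 \<union> E2. w f *\<^sub>R edge_vec f)" "\<forall>f\<in>E1 \<union> E2. 0 \<le> w f"
    using assms unfolding edge_cone_def by blast
  \<comment> \<open>Summing over \<open>E2 - E1\<close> lets the weight of a shared edge go to the
    first summand only.\<close>
  define z where "z = (\<Sum>f\<in>E2 - E1. w f *\<^sub>R edge_vec f)"
  have "z \<in> edge_cone (E2 - E1)" using w(2) unfolding edge_cone_def z_def by auto
  then have "z \<in> edge_cone E2" using edge_cone_mono[of "E2 - E1" E2] by blast
  moreover have "(\<Sum>f\<in>E1. w f *\<^sub>R edge_vec f) \<in> edge_cone E1"
    using w(2) unfolding edge_cone_def by auto
  moreover have "x = (\<Sum>f\<in>E1. w f *\<^sub>R edge_vec f) + z"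
    unfolding w(1) z_def by (subst sum.union_disjoint[symmetric]) auto
  ultimately show ?thesis using that by blast
qed

lemma edge_cone_nonneg:
  fixes E :: "'v::finite set set"
  assumes "x \<in> edge_cone E"
  shows "0 \<le> x $ i"
proof -
  obtain w where w: "x = (\<Sum>f\<in>E. w f *\<^sub>R edge_vec f)" "\<forall>f\<in>E. 0 \<le> w f"
    using assms unfolding edge_cone_def by blast
  show ?thesis unfolding w(1) edge_comb_nth using w(2) by (intro sum_nonneg) auto
qed

lemma edge_cone_supp:
  fixes E :: "'v::finite set set"
  assumes "x \<in> edge_cone E" and "i \<notin> \<Union>E"
  shows "x $ i = 0"
proof -
  obtain w where w: "x = (\<Sum>f\<in>E. w f *\<^sub>R edge_vec f)"
    using assms(1) unfolding edge_cone_def by blast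
  have none: "{f\<in>E. i \<in> f} = {}" using assms(2) by blast
  show ?thesis unfolding w edge_comb_nth none by simp
qed

lemma edge_cone_balanced:
  fixes E :: "'v::finite set set"
  assumes "bipartite_edges A B E" and "x \<in> edge_cone E"
  shows "(\<Sum>i\<in>A. x $ i) = (\<Sum>i\<in>B. x $ i)"
  using assms bipartite_comb_balanced[OF assms(1)] unfolding edge_cone_def by auto

lemma edge_cone_rounding:
  fixes E :: "'v::finite set set"
  assumes bip: "bipartite_edges A B E" and uv: "u \<in> A" "v \<in> B"
    and z: "z \<in> edge_cone E" "\<And>i. i \<notin> {u, v} \<Longrightarrow> z $ i \<in> \<int>"
  obtains z' c where "z' \<in> edge_cone E" "\<And>i. z' $ i \<in> \<int>" "0 \<le> c" "z = z' + c *\<^sub>R edge_vec {u, v}"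
proof -
  obtain w where w: "z = (\<Sum>f\<in>E. w f *\<^sub>R edge_vec f)" "\<And>f. f \<in> E \<Longrightarrow> 0 \<le> w f"
    using z(1) unfolding edge_cone_def by blast
  obtain w' c where w': "0 \<le> c" "\<forall>f\<in>E. 0 \<le> w' f \<and> w' f \<in> \<int>"
    "z = (\<Sum>f\<in>E. w' f *\<^sub>R edge_vec f) + c *\<^sub>R edge_vec {u, v}"
    using bipartite_weights_rounding[OF bip uv, of w] w z(2) by auto
  show ?thesis
  proof (rule that[OF _ _ w'(1,3)])
    show "(\<Sum>f\<in>E. w' f *\<^sub>R edge_vec f) \<in> edge_cone E"
      using w'(2) unfolding edge_cone_def by blast
    show "(\<Sum>f\<in>E. w' f *\<^sub>R edge_vec f) $ i \<in> \<int>" for i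
      using w'(2) unfolding edge_comb_nth by (intro Ints_sum) auto
  qed
qed

section \<open>Lattice points of the cone and Ehrhart coefficients\<close>

text \<open>The lattice points of degree \<open>m\<close>: for two-element edges every edge vector
  has coordinate sum 2, so total weight \<open>m\<close> means coordinate sum
  \<open>2 * m\<close>.\<close>

definition cone_points :: "'v::finite set set \<Rightarrow> nat \<Rightarrow> (real ^ 'v) set" where
  "cone_points E m = {x \<in> edge_cone E. (\<forall>i. x $ i \<in> \<int>) \<and> (\<Sum>i\<in>UNIV. x $ i) = 2 * real m}"

text \<open>Subtracting the integral vector of \<open>e\<close> preserves integrality, so only
  membership in the cone has to fail.\<close>

definition reduced_points :: "'v::finite set set \<Rightarrow> 'v set \<Rightarrow> nat \<Rightarrow> (real ^ 'v) set" where
  "reduced_points E e m = {z \<in> cone_points E m. z - edge_vec e \<notin> edge_cone E}"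

text \<open>The coordinates are nonnegative integers with sum \<open>2 * m\<close>, so each of them
  is at most \<open>2 * m\<close>.\<close>

lemma finite_cone_points: "finite (cone_points E m)"
  for E :: "'v::finite set set"
proof -
  have "cone_points E m \<subseteq> {x. \<forall>i. x $ i \<in> of_int ` {0..2 * int m}}"
  proof (intro subsetI CollectI allI)
    fix x and i :: 'v assume x: "x \<in> cone_points E m"
    then have nn: "0 \<le> x $ j" for j using edge_cone_nonneg unfolding cone_points_def by blast
    have "x $ i \<le> (\<Sum>j\<in>UNIV. x $ j)" using nn by (intro member_le_sum) auto
    then have "x $ i \<le> 2 * real m" using x unfolding cone_points_def by simp
    moreover obtain k where "x $ i = of_int k" using x unfolding cone_points_def by (blast elim: Ints_cases)
    ultimately show "x $ i \<in> of_int ` {0..2 * int m}" using nn[of i] by (auto intro!: image_eqI[of _ _ k])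
  qed
  also have "\<dots> \<subseteq> vec_lambda ` (UNIV \<rightarrow>\<^sub>E of_int ` {0..2 * int m})"
  proof
    fix x :: "real ^ 'v" assume "x \<in> {x. \<forall>i. x $ i \<in> of_int ` {0..2 * int m}}"
    then show "x \<in> vec_lambda ` (UNIV \<rightarrow>\<^sub>E of_int ` {0..2 * int m})"
      by (intro image_eqI[of _ _ "\<lambda>i. x $ i"]) (auto simp: vec_eq_iff)
  qed
  finally show ?thesis by (rule finite_subset) (intro finite_imageI finite_PiE; simp)
qed

lemma finite_reduced_points: "finite (reduced_points E e m)"
  for E :: "'v::finite set set"
  by (rule finite_subset[OF _ finite_cone_points[of E m]]) (auto simp: reduced_points_def)

text \<open>Convex weights times \<open>m\<close> are nonnegative weights of total \<open>m\<close>.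
  Since every edge has two vertices, the coordinate sum of a point determines this total; division
  by \<open>m > 0\<close> gives the converse.\<close>

lemma scaled_edge_polytope:
  fixes H :: "('v::finite) ugraph"
  assumes "simple_graph H" and "0 < m"
  shows "lattice_points ((\<lambda>x. real m *\<^sub>R x) ` edge_polytope H) = cone_points (edges H) m"
proof -
  have total: "(\<Sum>i\<in>UNIV. (\<Sum>f\<in>edges H. w f *\<^sub>R edge_vec f) $ i) = 2 * (\<Sum>f\<in>edges H. w f)" for w
  proof -
    have "card f = 2" if "f \<in> edges H" for f using assms that unfolding simple_graph_def by auto
    then show ?thesis unfolding sum_edge_comb by (simp add: sum_distrib_left mult.commute)
  qed
  \<comment> \<open>The description of the convex hull by \<open>convex_hull_finite\<close> puts
    weights on vectors; injectivity carries them over to edges.\<close>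
  have inj: "inj_on (edge_vec :: 'v set \<Rightarrow> _) S" for S
    by (rule inj_onI) (auto simp: vec_eq_iff edge_vec_nth split: if_splits)
  have poly: "edge_polytope H = {\<Sum>f\<in>edges H. w f *\<^sub>R edge_vec f | w. (\<forall>f\<in>edges H. 0 \<le> w f) \<and> sum w (edges H) = 1}"
    (is "_ = ?P")
  proof -
    have "edge_polytope H = convex hull (edge_vec ` edges H)"
      unfolding edge_polytope_def edge_vec_def ..
    also have "\<dots> = ?P"
      unfolding convex_hull_finite[OF finite_imageI[OF finite]] sum.reindex[OF inj] o_def
    proof (intro set_eqI iffI; clarsimp)
      fix w :: "'v set \<Rightarrow> real" assume w: "\<forall>f\<in>edges H. 0 \<le> w f" "sum w (edges H) = 1"
      then show "\<exists>u. (\<forall>x\<in>edges H. 0 \<le> u (edge_vec x)) \<and> (\<Sum>x\<in>edges H. u (edge_vec x)) = 1 \<and>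
        (\<Sum>x\<in>edges H. u (edge_vec x) *\<^sub>R edge_vec x) = (\<Sum>f\<in>edges H. w f *\<^sub>R edge_vec f)"
        by (intro exI[of _ "w \<circ> inv_into UNIV edge_vec"]) (simp add: inv_into_f_f[OF inj])
    qed (rule exI, auto)
    finally show ?thesis .
  qed
  have "(\<lambda>x. real m *\<^sub>R x) ` ?P = {x \<in> edge_cone (edges H). (\<Sum>i\<in>UNIV. x $ i) = 2 * real m}"
  proof (intro set_eqI iffI)
    fix x assume "x \<in> (\<lambda>x. real m *\<^sub>R x) ` ?P"
    then obtain w where w: "x = real m *\<^sub>R (\<Sum>f\<in>edges H. w f *\<^sub>R edge_vec f)"
      "\<forall>f\<in>edges H. 0 \<le> w f" "sum w (edges H) = 1" by blast
    have x: "x = (\<Sum>f\<in>edges H. (real m * w f) *\<^sub>R edge_vec f)" by (simp add: w(1) scaleR_sum_right)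
    have "(\<Sum>i\<in>UNIV. x $ i) = 2 * real m"
      unfolding x total by (simp add: w(3) flip: sum_distrib_left)
    then show "x \<in> {x \<in> edge_cone (edges H). (\<Sum>i\<in>UNIV. x $ i) = 2 * real m}"
      using x w(2) unfolding edge_cone_def by auto
  next
    fix x assume "x \<in> {x \<in> edge_cone (edges H). (\<Sum>i\<in>UNIV. x $ i) = 2 * real m}"
    then obtain w where w: "x = (\<Sum>f\<in>edges H. w f *\<^sub>R edge_vec f)" "\<forall>f\<in>edges H. 0 \<le> w f"
      "(\<Sum>i\<in>UNIV. x $ i) = 2 * real m" unfolding edge_cone_def by blast
    have "sum w (edges H) = real m" using w(3) unfolding w(1) total by simp
    then have "(\<Sum>f\<in>edges H. (w f / real m) *\<^sub>R edge_vec f) \<in> ?P"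
      using w(2) assms(2) by (auto intro!: exI[of _ "\<lambda>f. w f / real m"] simp flip: sum_divide_distrib)
    moreover have "x = real m *\<^sub>R (\<Sum>f\<in>edges H. (w f / real m) *\<^sub>R edge_vec f)"
      using assms(2) by (simp add: w(1) scaleR_sum_right)
    ultimately show "x \<in> (\<lambda>x. real m *\<^sub>R x) ` ?P" by blast
  qed
  then show ?thesis unfolding poly lattice_points_def cone_points_def by auto
qed

text \<open>Nonnegative coordinates with sum 0 all vanish. The single point matches the constant
  term 1 of the Ehrhart series, even for a graph without edges.\<close>

lemma cone_points_0: "cone_points E 0 = {0}"
  for E :: "'v::finite set set"
proof (intro set_eqI iffI)
  fix x assume x: "x \<in> cone_points E 0"
  then have "0 \<le> x $ i" for i using edge_cone_nonneg unfolding cone_points_def by blast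
  then have "\<forall>i\<in>UNIV. x $ i = 0"
    using x sum_nonneg_eq_0_iff[of UNIV "\<lambda>i. x $ i"] unfolding cone_points_def by simp
  then show "x \<in> {0}" by (simp add: vec_eq_iff)
next
  have "0 \<in> edge_cone E" unfolding edge_cone_def by (auto intro!: exI[of _ "\<lambda>_. 0"])
  then show "x \<in> cone_points E 0" if "x \<in> {0}" for x
    using that unfolding cone_points_def by simp
qed

lemma ehrhart_series_nth:
  "simple_graph H \<Longrightarrow> fps_nth (ehrhart_series H) m = int (card (cone_points (edges H) m))"
  by (simp add: ehrhart_series_def scaled_edge_polytope cone_points_0)

text \<open>A point of degree \<open>Suc m\<close> is either reduced or the translate by
  \<open>edge_vec e\<close> of a point of degree \<open>m\<close>, and translation is
  injective.\<close>

lemma card_reduced_points: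
  fixes E :: "'v::finite set set"
  assumes "e \<in> E" and "card e = 2"
  shows "card (cone_points E (Suc m)) = card (reduced_points E e (Suc m)) + card (cone_points E m)"
proof -
  have sum_e: "(\<Sum>i\<in>UNIV. edge_vec e $ i) = 2" by (simp add: sum_edge_vec assms)
  have e: "edge_vec e \<in> edge_cone E" using scaled_edge_in_edge_cone[OF assms(1), of 1] by simp
  have "cone_points E (Suc m) = reduced_points E e (Suc m) \<union> (\<lambda>x. x + edge_vec e) ` cone_points E m"
    (is "_ = _ \<union> ?S")
  proof (intro set_eqI iffI)
    fix x assume x: "x \<in> cone_points E (Suc m)"
    have "x - edge_vec e \<in> cone_points E m" if "x - edge_vec e \<in> edge_cone E"
      using x that sum_e unfolding cone_points_def
      by (auto simp: sum_subtractf edge_vec_nth)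
    then have "x \<in> ?S" if "x - edge_vec e \<in> edge_cone E"
      using that by (intro image_eqI[of _ _ "x - edge_vec e"]) auto
    then show "x \<in> reduced_points E e (Suc m) \<union> ?S" using x unfolding reduced_points_def by blast
  next
    fix x assume "x \<in> reduced_points E e (Suc m) \<union> ?S"
    then show "x \<in> cone_points E (Suc m)"
      using e sum_e unfolding reduced_points_def cone_points_def
      by (auto simp: sum.distrib edge_vec_nth intro: edge_cone_add)
  qed
  moreover have "reduced_points E e (Suc m) \<inter> ?S = {}"
    unfolding reduced_points_def cone_points_def by auto
  moreover have "card ?S = card (cone_points E m)" by (intro card_image inj_onI) simp
  ultimately show ?thesis by (simp add: card_Un_disjoint finite_cone_points finite_reduced_points)
qed

lemma ehrhart_series_times_one_minus_X_nth:
  fixes H :: "('v::finite) ugraph"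
  assumes "simple_graph H" and "e \<in> edges H"
  shows "fps_nth (ehrhart_series H * (1 - fps_X)) m = int (card (reduced_points (edges H) e m))"
proof -
  have card: "card e = 2" using assms unfolding simple_graph_def by auto
  show ?thesis
  proof (cases m)
    case 0
    obtain i where i: "i \<in> e" using card by fastforce
    \<comment> \<open>In degree 0 the only point is the origin, and it is reduced because
      subtracting the edge vector makes a coordinate negative.\<close>
    have "- edge_vec e \<notin> edge_cone (edges H)"
      using edge_cone_nonneg[of "- edge_vec e" "edges H" i] i by (auto simp: edge_vec_nth)
    then have "reduced_points (edges H) e 0 = {0}"
      unfolding reduced_points_def cone_points_0 by auto
    then show ?thesis using 0 by (simp add: ehrhart_series_def)
  next
    case (Suc k)
    then show ?thesis
      using card_reduced_points[OF assms(2) card, of k] assms(1)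
      by (simp add: ehrhart_series_nth algebra_simps)
  qed
qed

section \<open>Unique decomposition of lattice points\<close>

text \<open>Points of the cone have nonnegative coordinates, so a coordinate at a vertex of
  \<open>e\<close> bounds the admissible \<open>k\<close>; the largest one is taken.\<close>

lemma reduce_point:
  fixes E :: "'v::finite set set"
  assumes "z \<in> edge_cone E" and "e \<noteq> {}"
  obtains k :: nat where "z - real k *\<^sub>R edge_vec e \<in> edge_cone E"
    and "z - real (Suc k) *\<^sub>R edge_vec e \<notin> edge_cone E"
proof -
  define K where "K = {k::nat. z - real k *\<^sub>R edge_vec e \<in> edge_cone E}"
  obtain i where i: "i \<in> e" using assms(2) by auto
  have "k \<le> nat \<lceil>z $ i\<rceil>" if "k \<in> K" for k
  proof -
    have "0 \<le> (z - real k *\<^sub>R edge_vec e) $ i"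
      using that unfolding K_def by (intro edge_cone_nonneg) simp
    then have "real k \<le> z $ i" using i by (simp add: edge_vec_nth)
    then show ?thesis by linarith
  qed
  then have fin: "finite K" unfolding finite_nat_set_iff_bounded_le by blast
  moreover have "0 \<in> K" using assms(1) by (simp add: K_def)
  ultimately have "Max K \<in> K" by (intro Max_in) auto
  moreover have "Suc (Max K) \<notin> K" using Max_ge[OF fin, of "Suc (Max K)"] by auto
  ultimately show ?thesis using that unfolding K_def by blast
qed

text \<open>By balance, the difference of the two points is a multiple of the vector of
  \<open>{u, v}\<close>, and an integral one. A positive multiple would allow this vector to be
  subtracted from the larger point. The degrees \<open>k\<close> and \<open>k'\<close> are not
  assumed equal.\<close>

lemma reduced_points_unique:
  fixes E :: "'v::finite set set"
  assumes bip: "bipartite_edges A B E" and uv: "u \<in> A" "v \<in> B" "{u, v} \<in> E"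
    and z: "z \<in> reduced_points E {u, v} k" and z': "z' \<in> reduced_points E {u, v} k'"
    and off: "\<And>i. i \<notin> {u, v} \<Longrightarrow> z $ i = z' $ i"
  shows "z = z'"
proof -
  have *: "D \<le> 0" if "a \<in> reduced_points E {u, v} l" "b \<in> reduced_points E {u, v} l'"
    "a = b + D *\<^sub>R edge_vec {u, v}" "D \<in> \<int>" for a b D l l'
  proof (rule ccontr)
    assume "\<not> D \<le> 0"
    moreover obtain n where "D = of_int n" using \<open>D \<in> \<int>\<close> by (elim Ints_cases)
    \<comment> \<open>Integrality turns \<open>D > 0\<close> into \<open>D \<ge> 1\<close>, so one
      copy of the edge vector can be given up.\<close>
    ultimately have "D - 1 \<ge> 0" by simp
    then have "b + (D - 1) *\<^sub>R edge_vec {u, v} \<in> edge_cone E"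
      using that(2) uv(3) unfolding reduced_points_def cone_points_def
      by (intro edge_cone_add scaled_edge_in_edge_cone) auto
    moreover have "b + (D - 1) *\<^sub>R edge_vec {u, v} = a - edge_vec {u, v}"
      using that(3) by (simp add: scaleR_left_diff_distrib)
    ultimately show False using that(1) unfolding reduced_points_def by simp
  qed
  define D where "D = z - z'"
  have cone: "z \<in> edge_cone E" "z' \<in> edge_cone E" "\<forall>i. z $ i \<in> \<int>" "\<forall>i. z' $ i \<in> \<int>"
    using z z' unfolding reduced_points_def cone_points_def by auto
  have "D = (D $ u) *\<^sub>R edge_vec {u, v}"
  proof (rule balanced_on_edge[of A B])
    show "(\<Sum>i\<in>A. D $ i) = (\<Sum>i\<in>B. D $ i)"
      using edge_cone_balanced[OF bip] cone by (simp add: D_def sum_subtractf)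
  qed (use bip uv off in \<open>auto simp: D_def bipartite_edges_def\<close>)
  then have D: "z = z' + (D $ u) *\<^sub>R edge_vec {u, v}" "z' = z + (- D $ u) *\<^sub>R edge_vec {u, v}"
    by (simp_all add: D_def algebra_simps)
  have "D $ u \<in> \<int>" using cone by (simp add: D_def)
  then have "D $ u = 0" using *[OF z z' D(1)] *[OF z' z D(2)] by simp
  then show ?thesis using D(1) by simp
qed

text \<open>By balance the coordinate sum is twice the integer sum over \<open>A\<close>, hence
  even. In the cone of a triangle, by contrast, the point (1,1,1) has odd coordinate sum.\<close>

lemma bipartite_point_degree:
  fixes E :: "'v::finite set set"
  assumes bip: "bipartite_edges A B E" and z: "z \<in> edge_cone E" "\<And>i. z $ i \<in> \<int>"
  obtains k where "z \<in> cone_points E k"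
proof -
  have "(\<Sum>i\<in>UNIV. z $ i) = (\<Sum>i\<in>A \<union> B. z $ i)"
  proof (rule sum.mono_neutral_right)
    have "\<Union>E \<subseteq> A \<union> B" using bip unfolding bipartite_edges_def by fastforce
    then show "\<forall>i\<in>UNIV - (A \<union> B). z $ i = 0" using edge_cone_supp[OF z(1)] by blast
  qed auto
  also have "\<dots> = (\<Sum>i\<in>A. z $ i) + (\<Sum>i\<in>B. z $ i)"
    using bip unfolding bipartite_edges_def by (intro sum.union_disjoint) auto
  also have "\<dots> = 2 * (\<Sum>i\<in>A. z $ i)" using edge_cone_balanced[OF bip z(1)] by simp
  finally have sum: "(\<Sum>i\<in>UNIV. z $ i) = 2 * (\<Sum>i\<in>A. z $ i)" .
  have "(\<Sum>i\<in>A. z $ i) \<in> \<int>" using z(2) by (rule Ints_sum)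
  moreover have "0 \<le> (\<Sum>i\<in>A. z $ i)" using edge_cone_nonneg[OF z(1)] by (rule sum_nonneg)
  ultimately have "(\<Sum>i\<in>A. z $ i) \<in> \<nat>" by (simp add: Nats_altdef2)
  then obtain k where "(\<Sum>i\<in>A. z $ i) = real k" by (elim Nats_cases)
  then show ?thesis using that[of k] z sum unfolding cone_points_def by simp
qed

text \<open>Addition is a bijection from pairs of complementary degrees. It is injective because off
  \<open>{u, v}\<close> the sum determines the reduced summand, which is then unique. It is
  surjective because \<open>z\<close> can be rounded and reduced along the shared edge, whose vector
  \<open>y\<close> can absorb.\<close>

lemma card_cone_points_union:
  fixes E1 E2 :: "'v::finite set set"
  assumes bip: "bipartite_edges A B E2" and uv: "u \<in> A" "v \<in> B"
    and e: "{u, v} \<in> E1" "{u, v} \<in> E2" and meet: "\<Union>E1 \<inter> \<Union>E2 \<subseteq> {u, v}"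
  shows "card (cone_points (E1 \<union> E2) m) =
    (\<Sum>k=0..m. card (cone_points E1 k) * card (reduced_points E2 {u, v} (m - k)))"
proof -
  let ?e = "edge_vec {u, v}"
  let ?S = "SIGMA k:{0..m}. cone_points E1 k \<times> reduced_points E2 {u, v} (m - k)"
  let ?h = "\<lambda>(k, y, z). y + z"
  have "bij_betw ?h ?S (cone_points (E1 \<union> E2) m)"
  proof (rule bij_betw_imageI)
    show "inj_on ?h ?S"
    proof (rule inj_onI, clarsimp)
      fix k y z k' y' z'
      assume eq: "y + z = y' + z'"
        and y: "y \<in> cone_points E1 k" "y' \<in> cone_points E1 k'"
        and z: "z \<in> reduced_points E2 {u, v} (m - k)" "z' \<in> reduced_points E2 {u, v} (m - k')"
      have "z $ i = z' $ i" if "i \<notin> {u, v}" for i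
      proof (cases "i \<in> \<Union>E2")
        case True
        then have "i \<notin> \<Union>E1" using meet that by blast
        then have "y $ i = 0" "y' $ i = 0" using edge_cone_supp y unfolding cone_points_def by blast+
        then show ?thesis using arg_cong[OF eq, of "\<lambda>x. x $ i"] by simp
      next
        case False
        then have "z $ i = 0" "z' $ i = 0"
          using edge_cone_supp z unfolding cone_points_def reduced_points_def by blast+
        then show ?thesis by simp
      qed
      then have "z = z'" using reduced_points_unique[OF bip uv e(2) z] by blast
      moreover from this have "y = y'" using eq by simp
      moreover from this have "k = k'" using y unfolding cone_points_def by simp
      ultimately show "k = k' \<and> y = y' \<and> z = z'" by simp
    qed
    show "?h ` ?S = cone_points (E1 \<union> E2) m"
    proof (intro equalityI subsetI)
      fix x assume "x \<in> ?h ` ?S"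
      then obtain k y z where k: "k \<le> m" and x: "x = y + z"
        and y: "y \<in> cone_points E1 k" and z: "z \<in> cone_points E2 (m - k)"
        unfolding reduced_points_def by auto
      have "y \<in> edge_cone (E1 \<union> E2)" "z \<in> edge_cone (E1 \<union> E2)"
        using y z edge_cone_mono[of E1 "E1 \<union> E2"] edge_cone_mono[of E2 "E1 \<union> E2"]
        unfolding cone_points_def by blast+
      then have "x \<in> edge_cone (E1 \<union> E2)" unfolding x by (rule edge_cone_add)
      then show "x \<in> cone_points (E1 \<union> E2) m"
        using y z k unfolding cone_points_def x by (auto simp: sum.distrib of_nat_diff)
    next
      fix x assume x: "x \<in> cone_points (E1 \<union> E2) m"
      then obtain y z where yz: "y \<in> edge_cone E1" "z \<in> edge_cone E2" "x = y + z"
        using edge_cone_union unfolding cone_points_def by blast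
      \<comment> \<open>Away from the shared edge \<open>z\<close> either carries the whole integral
        coordinate of \<open>x\<close> or vanishes.\<close>
      have "z $ i \<in> \<int>" if "i \<notin> {u, v}" for i
      proof (cases "i \<in> \<Union>E2")
        case True
        then have "i \<notin> \<Union>E1" using meet that by blast
        then have "z $ i = x $ i" using edge_cone_supp[OF yz(1)] yz(3) by simp
        then show ?thesis using x unfolding cone_points_def by simp
      qed (use edge_cone_supp[OF yz(2)] in simp)
      then obtain z1 c where z1: "z1 \<in> edge_cone E2" "\<And>i. z1 $ i \<in> \<int>" "0 \<le> c" "z = z1 + c *\<^sub>R ?e"
        using edge_cone_rounding[OF bip uv yz(2)] by metis
      obtain n :: nat where n: "z1 - real n *\<^sub>R ?e \<in> edge_cone E2"
        "z1 - real (Suc n) *\<^sub>R ?e \<notin> edge_cone E2"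
        using reduce_point[OF z1(1), of "{u, v}"] by blast
      define z2 where "z2 = z1 - real n *\<^sub>R ?e"
      \<comment> \<open>All that was removed from \<open>z\<close> goes to \<open>y\<close>, which
        stays in its cone since \<open>{u, v}\<close> lies in \<open>E1\<close>. Integrality of
        \<open>y2\<close> comes later, from \<open>y2 = x - z2\<close>.\<close>
      define y2 where "y2 = y + (c + real n) *\<^sub>R ?e"
      have z2_int: "z2 $ i \<in> \<int>" for i using z1(2) by (auto simp: z2_def edge_vec_nth)
      have x2: "x = y2 + z2" by (simp add: yz(3) z1(4) y2_def z2_def algebra_simps)
      obtain l where l: "z2 \<in> cone_points E2 l"
        using bipartite_point_degree[OF bip n(1)] z2_int unfolding z2_def by blast
      moreover have "z2 - ?e \<notin> edge_cone E2" using n(2) by (simp add: z2_def algebra_simps)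
      ultimately have z2: "z2 \<in> reduced_points E2 {u, v} l" unfolding reduced_points_def by simp
      have y2_cone: "y2 \<in> edge_cone E1"
        unfolding y2_def using yz(1) z1(3) e(1) by (intro edge_cone_add scaled_edge_in_edge_cone) auto
      have "(\<Sum>i\<in>UNIV. x $ i) = (\<Sum>i\<in>UNIV. y2 $ i) + (\<Sum>i\<in>UNIV. z2 $ i)"
        by (simp add: x2 sum.distrib)
      then have sum: "2 * real m = (\<Sum>i\<in>UNIV. y2 $ i) + 2 * real l"
        using x l unfolding cone_points_def by simp
      moreover have "0 \<le> (\<Sum>i\<in>UNIV. y2 $ i)" using edge_cone_nonneg[OF y2_cone] by (rule sum_nonneg)
      ultimately have lm: "l \<le> m" by simp
      have "y2 $ i = x $ i - z2 $ i" for i by (simp add: x2)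
      then have "y2 $ i \<in> \<int>" for i using x z2_int unfolding cone_points_def by simp
      then have "y2 \<in> cone_points E1 (m - l)"
        using y2_cone sum lm unfolding cone_points_def by (simp add: of_nat_diff)
      then show "x \<in> ?h ` ?S"
        using z2 lm x2 by (intro image_eqI[of _ _ "(m - l, y2, z2)"]) auto
    qed
  qed
  then have "card (cone_points (E1 \<union> E2) m) = card ?S" by (simp add: bij_betw_same_card)
  also have "\<dots> = (\<Sum>k=0..m. card (cone_points E1 k) * card (reduced_points E2 {u, v} (m - k)))"
    by (subst card_SigmaI) (simp_all add: card_cartesian_product finite_cone_points finite_reduced_points)
  finally show ?thesis .
qed

theorem theorem3p5:
  fixes G G1 G2 :: "('v::finite) ugraph" and e :: "'v set"
  assumes "simple_graph G" and "connected_graph G"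
    and "subgraph G1 G" and "subgraph G2 G"
    and "edges G \<subseteq> edges G1 \<union> edges G2"
    and "edges G1 \<inter> edges G2 = {e}"
    and "verts G1 \<inter> verts G2 = e"
    and "bipartite G2"
    and "\<exists>vs. cycle_of G2 vs \<and> e \<in> cycle_edges vs"
  shows "ehrhart_series G = ehrhart_series G1 * (ehrhart_series G2 * (1 - fps_X))"
proof (rule fps_ext)
  fix m
  have simple: "simple_graph G1" "simple_graph G2" and E: "edges G = edges G1 \<union> edges G2"
    using assms(3,4,5) unfolding subgraph_def by auto
  obtain A B where bip: "bipartite_edges A B (edges G2)"
    using assms(8) unfolding bipartite_def bipartite_edges_def by blast
  have e: "e \<in> edges G1" "e \<in> edges G2" using assms(6) by auto
  then obtain u v where uv: "u \<in> A" "v \<in> B" "e = {u, v}"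
    using bip unfolding bipartite_edges_def by blast
  \<comment> \<open>The condition on common vertices ensures that edges of the two subgraphs meet
    only in ends of \<open>e\<close>.\<close>
  have "\<Union>(edges G1) \<inter> \<Union>(edges G2) \<subseteq> verts G1 \<inter> verts G2"
    using simple unfolding simple_graph_def by blast
  then have meet: "\<Union>(edges G1) \<inter> \<Union>(edges G2) \<subseteq> {u, v}" using assms(7) uv(3) by simp
  \<comment> \<open>The sum in \<open>card_cone_points_union\<close> is the coefficient of the
    Cauchy product.\<close>
  show "fps_nth (ehrhart_series G) m =
    fps_nth (ehrhart_series G1 * (ehrhart_series G2 * (1 - fps_X))) m"
    using card_cone_points_union[OF bip uv(1,2) _ _ meet, of m] e assms(1)
    unfolding fps_mult_nth[of "ehrhart_series G1"] ehrhart_series_times_one_minus_X_nth[OF simple(2) e(2)]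
      ehrhart_series_nth[OF simple(1)] ehrhart_series_nth[OF assms(1)] E uv(3)
    by simp
qed

end
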